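(* Not every positively associated measure is FUI: there exist an integer $n\ge 1$ and a probability measure $\mu$ on $\{0,1\}^n$ such that $\mu$ is positively associated but $\mu$ is not FUI.
   Context: $\{0,1\}^n$ carries the coordinatewise partial order. An event $\mathcal{A}\subseteq\{0,1\}^n$ is increasing if $x\in\mathcal{A}$ and $x\le y$ imply $y\in\mathcal{A}$. A probability measure $\mu$ on $\{0,1\}^n$ is positively associated (PA) if $\mu(\mathcal{A}\cap\mathcal{B})\ge\mu(\mathcal{A})\mu(\mathcal{B})$ for all increasing events $\mathcal{A},\mathcal{B}\subseteq\{0,1\}^n$. A Bernoulli random variable is a $\{0,1\}$-valued random variable (with arbitrary parameter; different Bernoullis need not be identically distributed). A probability measure $\mu$ on $\{0,1\}^n$ is FUI ("finitely many underlying independents") if it is the law of a random vector $(X_1,\ldots,X_n)$ for which there exist a finite $m$, independent Bernoulli random variables $Y_1,\ldots,Y_m$, and increasing (i.e. coordinatewise nondecreasing) functions $f_1,\ldots,f_n:\{0,1\}^m\to\{0,1\}$ such that $X_i=f_i(Y_1,\ldots,Y_m)$ for every $i\in\{1,\ldots,n\}$. *)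

theory Defs
  imports "HOL-Probability.Probability"
begin

text \<open>
  The hypercube consists of the extensional functions from \<open>{..<n}\<close> to \<open>bool\<close>, with \<open>False\<close> for 0
  and \<open>True\<close> for 1. All its members agree outside \<open>{..<n}\<close>, so the pointwise order on functions
  restricts to the coordinatewise order.
\<close>

definition cube :: "nat \<Rightarrow> (nat \<Rightarrow> bool) set" where
  "cube n = {..<n} \<rightarrow>\<^sub>E UNIV"

definition prob_measure_on_cube :: "nat \<Rightarrow> (nat \<Rightarrow> bool) measure \<Rightarrow> bool" where
  "prob_measure_on_cube n \<mu> \<longleftrightarrow> prob_space \<mu> \<and> space \<mu> = cube n \<and> sets \<mu> = Pow (cube n)"

definition increasing_event :: "nat \<Rightarrow> (nat \<Rightarrow> bool) set \<Rightarrow> bool" where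
  "increasing_event n A \<longleftrightarrow> A \<subseteq> cube n \<and> (\<forall>x\<in>A. \<forall>y\<in>cube n. x \<le> y \<longrightarrow> y \<in> A)"

definition positively_associated :: "nat \<Rightarrow> (nat \<Rightarrow> bool) measure \<Rightarrow> bool" where
  "positively_associated n \<mu> \<longleftrightarrow>
    (\<forall>A B. increasing_event n A \<longrightarrow> increasing_event n B \<longrightarrow>
      measure \<mu> (A \<inter> B) \<ge> measure \<mu> A * measure \<mu> B)"

text \<open>
  Bernoulli variables are \<open>bool\<close>-valued random variables; their measurability is part of
  \<open>indep_vars\<close>, and their parameters are unrestricted.
\<close>

definition FUI_over :: "'a measure \<Rightarrow> nat \<Rightarrow> (nat \<Rightarrow> bool) measure \<Rightarrow> bool" where
  "FUI_over M n \<mu> \<longleftrightarrow>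
    prob_space M \<and>
    (\<exists>(m :: nat) (Y :: nat \<Rightarrow> 'a \<Rightarrow> bool) (f :: nat \<Rightarrow> (nat \<Rightarrow> bool) \<Rightarrow> bool).
      prob_space.indep_vars M (\<lambda>_. count_space UNIV) Y {..<m} \<and>
      (\<forall>i<n. mono_on (cube m) (f i)) \<and>
      \<mu> = distr M (count_space (cube n)) (\<lambda>\<omega>. \<lambda>i\<in>{..<n}. f i (\<lambda>j\<in>{..<m}. Y j \<omega>)))"

text \<open>
  A definition cannot quantify over the type of the sample space. Fixing it to \<open>nat \<Rightarrow> bool\<close> loses
  nothing, by \<open>FUI_overD\<close> below.
\<close>

definition FUI :: "nat \<Rightarrow> (nat \<Rightarrow> bool) measure \<Rightarrow> bool" where
  "FUI n \<mu> \<longleftrightarrow> (\<exists>M :: (nat \<Rightarrow> bool) measure. FUI_over M n \<mu>)"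

lemma finite_cube: "finite (cube n)"
  unfolding cube_def by (intro finite_PiE) auto

lemma FUI_overD:
  fixes M :: "'a measure"
  assumes "FUI_over M n \<mu>"
  shows "FUI n \<mu>"
proof -
  interpret prob_space M using assms by (simp add: FUI_over_def)
  have "\<exists>m Y f. indep_vars (\<lambda>_. count_space UNIV) Y {..<m::nat} \<and>
      (\<forall>i<n. mono_on (cube m) (f i)) \<and>
      \<mu> = distr M (count_space (cube n)) (\<lambda>\<omega>. \<lambda>i\<in>{..<n}. f i (\<lambda>j\<in>{..<m}. Y j \<omega>))"
    using assms unfolding FUI_over_def by (rule conjunct2)
  then obtain m Y f where ind: "indep_vars (\<lambda>_. count_space UNIV) Y {..<m}"
    and mono: "\<forall>i<n. mono_on (cube m) (f i)"
    and \<mu>: "\<mu> = distr M (count_space (cube n)) (\<lambda>\<omega>. \<lambda>i\<in>{..<n}. f i (\<lambda>j\<in>{..<m}. Y j \<omega>))"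
    by (elim exE conjE) (erule that, assumption, assumption)
  define \<phi> where "\<phi> = (\<lambda>\<omega>. \<lambda>j\<in>{..<m}. Y j \<omega>)"
  define N where "N = distr M (count_space (cube m)) \<phi>"
  have Y: "Y j \<in> measurable M (count_space UNIV)" if "j < m" for j
    using ind that by (simp add: indep_vars_def2)
  have \<phi>_cube: "\<phi> \<omega> \<in> cube m" for \<omega>
    by (simp add: \<phi>_def cube_def)
  have \<phi>: "\<phi> \<in> measurable M (count_space (cube m))"
  proof (subst measurable_count_space_eq2[OF finite_cube], intro conjI ballI)
    show "\<phi> \<in> space M \<rightarrow> cube m" using \<phi>_cube by simp
    fix x assume x: "x \<in> cube m"
    have "\<phi> -` {x} \<inter> space M = {\<omega> \<in> space M. \<forall>j\<in>{..<m}. Y j \<omega> = x j}"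
      using x by (auto simp: \<phi>_def cube_def fun_eq_iff PiE_def extensional_def)
    also have "\<dots> \<in> sets M"
    proof (rule sets.sets_Collect_finite_All)
      fix j assume "j \<in> {..<m}"
      then have "Y j -` {x j} \<inter> space M \<in> sets M"
        by (intro measurable_sets[OF Y]) auto
      also have "Y j -` {x j} \<inter> space M = {\<omega> \<in> space M. Y j \<omega> = x j}" by auto
      finally show "{\<omega> \<in> space M. Y j \<omega> = x j} \<in> sets M" .
    qed auto
    finally show "\<phi> -` {x} \<inter> space M \<in> sets M" .
  qed
  interpret N: prob_space N unfolding N_def by (rule prob_space_distr[OF \<phi>])
  have sN: "space N = cube m" "sets N = Pow (cube m)" by (auto simp: N_def)
  have \<phi>_pre: "\<phi> -` ((\<lambda>x. x j) -` A \<inter> cube m) \<inter> space M = Y j -` A \<inter> space M" if "j < m" for j A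
    using \<phi>_cube that by (auto simp: \<phi>_def)
  have indN: "N.indep_vars (\<lambda>_. count_space UNIV) (\<lambda>j x. x j) {..<m}"
    unfolding N.indep_vars_def2
  proof (intro conjI ballI)
    fix j assume "j \<in> {..<m}"
    show "(\<lambda>x. x j) \<in> measurable N (count_space UNIV)"
      by (auto simp: measurable_def sN)
  next
    show "N.indep_sets (\<lambda>j. {(\<lambda>x. x j) -` A \<inter> space N |A. A \<in> sets (count_space UNIV)}) {..<m}"
    proof (rule N.indep_setsI)
      fix A J assume J: "J \<noteq> {}" "J \<subseteq> {..<m}" "finite J"
        and A: "\<forall>j\<in>J. A j \<in> {(\<lambda>x. x j) -` B \<inter> space N |B. B \<in> sets (count_space UNIV)}"
      have "\<forall>j\<in>J. \<exists>B. A j = (\<lambda>x. x j) -` B \<inter> cube m"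
        using A by (auto simp: sN)
      from bchoice[OF this] obtain B
        where B': "\<forall>j\<in>J. A j = (\<lambda>x. x j) -` B j \<inter> cube m" ..
      have B: "A j = (\<lambda>x. x j) -` B j \<inter> cube m" if "j \<in> J" for j
        using B' that by (rule bspec)
      have \<phi>_A: "\<phi> -` A j \<inter> space M = Y j -` B j \<inter> space M" if "j \<in> J" for j
        unfolding B[OF that] using that J by (intro \<phi>_pre) auto
      have A_cube: "A j \<in> sets (count_space (cube m))" if "j \<in> J" for j
        using B[OF that] by simp
      have pA: "N.prob (A j) = prob (Y j -` B j \<inter> space M)" if "j \<in> J" for j
        unfolding N_def measure_distr[OF \<phi> A_cube[OF that]] \<phi>_A[OF that] by (rule refl)
      have sub: "(\<Inter>j\<in>J. A j) \<subseteq> cube m" using J B by blast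
      have "N.prob (\<Inter>j\<in>J. A j) = prob (\<phi> -` (\<Inter>j\<in>J. A j) \<inter> space M)"
        unfolding N_def using sub by (subst measure_distr[OF \<phi>]) auto
      also have "\<phi> -` (\<Inter>j\<in>J. A j) \<inter> space M = (\<Inter>j\<in>J. \<phi> -` A j \<inter> space M)"
        using J by auto
      also have "\<dots> = (\<Inter>j\<in>J. Y j -` B j \<inter> space M)"
        by (intro INF_cong refl \<phi>_A)
      also have "prob \<dots> = (\<Prod>j\<in>J. prob (Y j -` B j \<inter> space M))"
        using J by (intro indep_varsD[OF ind]) auto
      also have "\<dots> = (\<Prod>j\<in>J. N.prob (A j))" using pA by simp
      finally show "N.prob (\<Inter>j\<in>J. A j) = (\<Prod>j\<in>J. N.prob (A j))" .
    qed (auto simp: sN)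
  qed
  have \<mu>N: "\<mu> = distr N (count_space (cube n)) (\<lambda>x. \<lambda>i\<in>{..<n}. f i (\<lambda>j\<in>{..<m}. x j))"
  proof -
    have "(\<lambda>x. \<lambda>i\<in>{..<n}. f i (\<lambda>j\<in>{..<m}. x j)) \<in>
        measurable (count_space (cube m)) (count_space (cube n))"
      by (auto simp: cube_def)
    moreover have "(\<lambda>j\<in>{..<m}. \<phi> \<omega> j) = (\<lambda>j\<in>{..<m}. Y j \<omega>)" for \<omega>
      by (auto simp: \<phi>_def)
    ultimately show ?thesis
      unfolding \<mu> N_def by (subst distr_distr[OF _ \<phi>]) (auto simp: comp_def)
  qed
  have "FUI_over N n \<mu>"
    unfolding FUI_over_def
    by (rule conjI[OF N.prob_space_axioms], rule exI[of _ m], rule exI[of _ "\<lambda>j x. x j"],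
        rule exI[of _ f], rule conjI[OF indN conjI[OF mono \<mu>N]])
  then show ?thesis unfolding FUI_def by (rule exI)
qed

end

theory Submission
  imports Defs
begin

text \<open>
  For increasing functions \<open>F\<close>, \<open>G\<close> of independent Bernoulli variables, the covariance is at least
  \<open>p\<^sub>i (1 - p\<^sub>i) E[D\<^sub>i F] E[D\<^sub>i G]\<close> for every coordinate \<open>i\<close>, where \<open>D\<^sub>i\<close> is the discrete derivative.
  So uncorrelated increasing functions depend on disjoint sets of coordinates.

  Let \<open>a\<close>, \<open>b\<close> be independent fair coins and let \<open>(u, v)\<close> be, given \<open>(a, b)\<close>, uniform on
  \<open>{00, 10}\<close>, \<open>{00, 11}\<close>, \<open>{00, 01, 10, 11}\<close>, \<open>{10, 11}\<close> for \<open>(a, b) = 00, 01, 10, 11\<close>. These four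
  laws are positively associated and stochastically increasing in \<open>(a, b)\<close>, so the law of
  \<open>(a, b, u, v)\<close> is positively associated. Moreover \<open>a\<close> is uncorrelated with \<open>b\<close>, \<open>b \<or> u\<close> and
  \<open>b \<and> v\<close>, and \<open>b\<close> is uncorrelated with \<open>a \<or> u\<close> and \<open>a \<and> v\<close>. If all four were increasing functions
  of independent Bernoulli variables, one could start from an outcome with \<open>(a, b, u, v) = 1010\<close> and
  resample the coordinates relevant for \<open>a\<close> and those relevant for \<open>b\<close> so as to reach \<open>0110\<close>, which
  has probability zero.
\<close>

subsection \<open>Expectations under product weights\<close>

text \<open>The expectation of \<open>F\<close> when the coordinates are independent with weights
  \<open>q j\<close>. The index set is arbitrary so that coordinates can be split off one at a
  time.\<close>

definition bexp :: "('i \<Rightarrow> bool \<Rightarrow> real) \<Rightarrow> 'i set \<Rightarrow> (('i \<Rightarrow> bool) \<Rightarrow> real) \<Rightarrow> real" where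
  "bexp q I F = (\<Sum>x\<in>I \<rightarrow>\<^sub>E UNIV. (\<Prod>j\<in>I. q j (x j)) * F x)"

lemma bexp_empty [simp]: "bexp q {} F = F (\<lambda>_. undefined)"
  by (simp add: bexp_def)

lemma bexp_insert:
  assumes "finite I" "i \<notin> I"
  shows "bexp q (insert i I) F =
    q i True * bexp q I (\<lambda>x. F (x(i := True))) + q i False * bexp q I (\<lambda>x. F (x(i := False)))"
proof -
  have w: "(\<Prod>j\<in>I. q j ((g(i := y)) j)) = (\<Prod>j\<in>I. q j (g j))" for g y
    using assms by (intro prod.cong) auto
  let ?c = "\<lambda>(y, g). g(i := y)" and ?S = "UNIV \<times> (I \<rightarrow>\<^sub>E UNIV)"
  have inj: "inj_on ?c ?S"
    using inj_combinator[OF assms(2), of "\<lambda>_. UNIV"] .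
  have "bexp q (insert i I) F = (\<Sum>x\<in>?c ` ?S. (\<Prod>j\<in>insert i I. q j (x j)) * F x)"
    by (simp only: bexp_def PiE_insert_eq)
  also have "\<dots> = (\<Sum>(y, g)\<in>?S. q i y * (\<Prod>j\<in>I. q j (g j)) * F (g(i := y)))"
    unfolding sum.reindex[OF inj] using assms w
    by (intro sum.cong refl) (simp add: split_def del: fun_upd_apply, simp)
  also have "\<dots> = (\<Sum>y\<in>UNIV. \<Sum>g\<in>I \<rightarrow>\<^sub>E UNIV. q i y * (\<Prod>j\<in>I. q j (g j)) * F (g(i := y)))"
    by (simp add: sum.cartesian_product)
  finally show ?thesis
    by (simp add: UNIV_bool bexp_def sum_distrib_left mult.assoc)
qed

lemma bexp_diff: "bexp q I (\<lambda>x. F x - G x) = bexp q I F - bexp q I G"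
  by (simp add: bexp_def right_diff_distrib sum_subtractf)

lemma bexp_nonneg:
  assumes "\<And>j b. q j b \<ge> 0" and "\<And>x. x \<in> I \<rightarrow>\<^sub>E UNIV \<Longrightarrow> F x \<ge> 0"
  shows "bexp q I F \<ge> 0"
  unfolding bexp_def using assms by (intro sum_nonneg mult_nonneg_nonneg prod_nonneg) auto

lemma bexp_pos:
  assumes "finite I" and "\<And>j b. q j b \<ge> 0" and "\<And>x. x \<in> I \<rightarrow>\<^sub>E UNIV \<Longrightarrow> F x \<ge> 0"
    and "x \<in> I \<rightarrow>\<^sub>E UNIV" and "\<And>j. j \<in> I \<Longrightarrow> q j (x j) > 0" and "F x > 0"
  shows "bexp q I F > 0"
  unfolding bexp_def
proof (rule sum_pos2)
  show "finite (I \<rightarrow>\<^sub>E (UNIV :: bool set))"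
    using assms(1) by (intro finite_PiE) auto
  show "0 < (\<Prod>j\<in>I. q j (x j)) * F x"
    using assms by (intro mult_pos_pos prod_pos) auto
qed (use assms in \<open>auto intro!: mult_nonneg_nonneg prod_nonneg\<close>)

section \<open>Harris inequality with a lower bound on the covariance\<close>

lemma mono_on_fun_upd:
  fixes F :: "('i \<Rightarrow> bool) \<Rightarrow> 'b::order"
  assumes "mono_on (insert i I \<rightarrow>\<^sub>E UNIV) F"
  shows "mono_on (I \<rightarrow>\<^sub>E UNIV) (\<lambda>x. F (x(i := b)))"
proof (rule mono_onI)
  fix x y :: "'i \<Rightarrow> bool"
  assume "x \<in> I \<rightarrow>\<^sub>E UNIV" "y \<in> I \<rightarrow>\<^sub>E UNIV" "x \<le> y"
  then show "F (x(i := b)) \<le> F (y(i := b))"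
    by (intro mono_onD[OF assms] PiE_fun_upd) (auto simp: le_fun_def)
qed

lemma mono_on_fun_upd_le:
  fixes F :: "('i \<Rightarrow> bool) \<Rightarrow> 'b::order"
  assumes "mono_on (insert i I \<rightarrow>\<^sub>E UNIV) F" and "x \<in> I \<rightarrow>\<^sub>E UNIV"
  shows "F (x(i := False)) \<le> F (x(i := True))"
  using assms(2) by (intro mono_onD[OF assms(1)] PiE_fun_upd) (auto simp: le_fun_def)

text \<open>The last term is the exact covariance of two variables taking the values
  \<open>a\<close>, \<open>c\<close> and \<open>b\<close>, \<open>d\<close> with probabilities
  \<open>p\<close>, \<open>q\<close>.\<close>

lemma two_point_covariance:
  fixes p q a b c d :: real
  assumes "p + q = 1"
  shows "p * (a * b) + q * (c * d) =
    (p * a + q * c) * (p * b + q * d) + p * q * (a - c) * (b - d)"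
proof -
  have q: "q = 1 - p" using assms by simp
  show ?thesis unfolding q by algebra
qed

text \<open>Law of total covariance, conditioning on coordinate \<open>i\<close>:
  \<open>harris\<close> makes both conditional covariances nonnegative, and the covariance of the
  conditional expectations is the derivative term. With \<open>harris\<close> as a hypothesis, the
  bound serves both in the induction for Harris and, afterwards, at any chosen coordinate.\<close>

lemma bexp_covariance_step:
  assumes "finite I" "i \<notin> I" and q: "\<And>j b. q j b \<ge> 0" "\<And>j. q j True + q j False = 1"
    and harris: "\<And>F G. \<lbrakk>mono_on (I \<rightarrow>\<^sub>E UNIV) F; mono_on (I \<rightarrow>\<^sub>E UNIV) G\<rbrakk> \<Longrightarrow>
      bexp q I F * bexp q I G \<le> bexp q I (\<lambda>x. F x * G x)"
    and F: "mono_on (insert i I \<rightarrow>\<^sub>E UNIV) F" and G: "mono_on (insert i I \<rightarrow>\<^sub>E UNIV) G"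
  shows "bexp q (insert i I) F * bexp q (insert i I) G
      + q i True * q i False * bexp q I (\<lambda>x. F (x(i := True)) - F (x(i := False)))
        * bexp q I (\<lambda>x. G (x(i := True)) - G (x(i := False)))
    \<le> bexp q (insert i I) (\<lambda>x. F x * G x)"
proof -
  let ?F = "\<lambda>b. bexp q I (\<lambda>x. F (x(i := b)))" and ?G = "\<lambda>b. bexp q I (\<lambda>x. G (x(i := b)))"
  have "bexp q (insert i I) F * bexp q (insert i I) G
      + q i True * q i False * (?F True - ?F False) * (?G True - ?G False)
    = q i True * (?F True * ?G True) + q i False * (?F False * ?G False)"
    using two_point_covariance[OF q(2)] by (simp add: bexp_insert[OF assms(1,2)])
  also have "\<dots> \<le> q i True * bexp q I (\<lambda>x. F (x(i := True)) * G (x(i := True)))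
      + q i False * bexp q I (\<lambda>x. F (x(i := False)) * G (x(i := False)))"
    by (intro add_mono mult_left_mono harris mono_on_fun_upd F G q)
  finally show ?thesis
    by (simp add: bexp_insert[OF assms(1,2)] bexp_diff)
qed

lemma bexp_harris:
  assumes "finite I" and q: "\<And>j b. q j b \<ge> 0" "\<And>j. q j True + q j False = 1"
    and "mono_on (I \<rightarrow>\<^sub>E UNIV) F" "mono_on (I \<rightarrow>\<^sub>E UNIV) G"
  shows "bexp q I F * bexp q I G \<le> bexp q I (\<lambda>x. F x * G x)"
  using assms(1,4,5)
proof (induction I arbitrary: F G rule: finite_induct)
  case empty
  then show ?case by simp
next
  case (insert i I)
  have "0 \<le> bexp q I (\<lambda>x. H (x(i := True)) - H (x(i := False)))"
    if "mono_on (insert i I \<rightarrow>\<^sub>E UNIV) H" for H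
    using mono_on_fun_upd_le[OF that] by (intro bexp_nonneg q) simp
  then have "0 \<le> q i True * q i False * bexp q I (\<lambda>x. F (x(i := True)) - F (x(i := False)))
        * bexp q I (\<lambda>x. G (x(i := True)) - G (x(i := False)))"
    using insert.prems by (intro mult_nonneg_nonneg q) auto
  moreover have "bexp q (insert i I) F * bexp q (insert i I) G
      + q i True * q i False * bexp q I (\<lambda>x. F (x(i := True)) - F (x(i := False)))
        * bexp q I (\<lambda>x. G (x(i := True)) - G (x(i := False)))
    \<le> bexp q (insert i I) (\<lambda>x. F x * G x)"
    by (rule bexp_covariance_step) (fact insert.hyps insert.prems q | rule insert.IH, assumption+)+
  ultimately show ?case by linarith
qed

subsection \<open>Relevant coordinates\<close>

text \<open>
  Degenerate coordinates are frozen at their almost sure value, so relevance is tested on the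
  support of the product weights only.
\<close>

definition supp :: "('i \<Rightarrow> bool \<Rightarrow> real) \<Rightarrow> 'i set \<Rightarrow> ('i \<Rightarrow> bool) set" where
  "supp q I = {x \<in> I \<rightarrow>\<^sub>E UNIV. \<forall>j\<in>I. q j (x j) > 0}"

definition relevant :: "('i \<Rightarrow> bool \<Rightarrow> real) \<Rightarrow> 'i set \<Rightarrow> (('i \<Rightarrow> bool) \<Rightarrow> 'b) \<Rightarrow> 'i set" where
  "relevant q I F = {i \<in> I. \<exists>x. x(i := True) \<in> supp q I \<and> x(i := False) \<in> supp q I \<and>
     F (x(i := True)) \<noteq> F (x(i := False))}"

text \<open>Monotonicity makes the derivative nonnegative everywhere, and relevance supplies a point
  of positive weight where it does not vanish.\<close>

lemma bexp_derivative_pos: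
  assumes "finite I" and q: "\<And>j b. q j b \<ge> 0"
    and F: "mono_on (I \<rightarrow>\<^sub>E UNIV) F" and i: "i \<in> relevant q I F"
  shows "0 < bexp q (I - {i}) (\<lambda>x. F (x(i := True)) - F (x(i := False)))"
proof -
  have iI: "insert i (I - {i}) = I" using i by (auto simp: relevant_def)
  obtain x where x: "x(i := True) \<in> supp q I" "x(i := False) \<in> supp q I"
      "F (x(i := True)) \<noteq> F (x(i := False))"
    using i by (auto simp: relevant_def)
  \<comment> \<open>Resetting coordinate \<open>i\<close> makes the point extensional on
    \<open>I - {i}\<close> and leaves both updates at \<open>i\<close> unchanged.\<close>
  define y where "y = x(i := undefined)"
  have y: "y \<in> I - {i} \<rightarrow>\<^sub>E UNIV"
    using x(1) by (auto simp: y_def supp_def PiE_def extensional_def split: if_splits)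
  have le: "F (z(i := False)) \<le> F (z(i := True))" if "z \<in> I - {i} \<rightarrow>\<^sub>E UNIV" for z
    using mono_on_fun_upd_le[of i "I - {i}" F z] F that iI by simp
  show ?thesis
  proof (rule bexp_pos)
    show "y \<in> I - {i} \<rightarrow>\<^sub>E UNIV" by (rule y)
    show "q j (y j) > 0" if "j \<in> I - {i}" for j
      using x(1) that by (auto simp: y_def supp_def split: if_splits)
    show "0 < F (y(i := True)) - F (y(i := False))"
      using x(3) le[OF y] by (simp add: y_def)
  qed (use assms le in auto)
qed

text \<open>At a common relevant coordinate both expected derivatives are positive, so the
  covariance would be strictly positive.\<close>

lemma relevant_disjoint:
  assumes "finite I" and q: "\<And>j b. q j b \<ge> 0" "\<And>j. q j True + q j False = 1"
    and F: "mono_on (I \<rightarrow>\<^sub>E UNIV) F" and G: "mono_on (I \<rightarrow>\<^sub>E UNIV) G"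
    and uncorrelated: "bexp q I (\<lambda>x. F x * G x) = bexp q I F * bexp q I G"
  shows "relevant q I F \<inter> relevant q I G = {}"
proof (rule ccontr)
  assume "relevant q I F \<inter> relevant q I G \<noteq> {}"
  then obtain i where i: "i \<in> relevant q I F" "i \<in> relevant q I G" by auto
  then have iI: "i \<in> I" and "q i True > 0" "q i False > 0"
    by (auto simp: relevant_def supp_def)
  then have "0 < q i True * q i False
      * bexp q (I - {i}) (\<lambda>x. F (x(i := True)) - F (x(i := False)))
      * bexp q (I - {i}) (\<lambda>x. G (x(i := True)) - G (x(i := False)))"
    using bexp_derivative_pos[OF assms(1) q(1) F i(1)] bexp_derivative_pos[OF assms(1) q(1) G i(2)]
    by simp
  moreover have "bexp q (insert i (I - {i})) F * bexp q (insert i (I - {i})) G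
      + q i True * q i False
        * bexp q (I - {i}) (\<lambda>x. F (x(i := True)) - F (x(i := False)))
        * bexp q (I - {i}) (\<lambda>x. G (x(i := True)) - G (x(i := False)))
    \<le> bexp q (insert i (I - {i})) (\<lambda>x. F x * G x)"
  proof (rule bexp_covariance_step)
    show "finite (I - {i})" using assms(1) by simp
    then show "bexp q (I - {i}) F' * bexp q (I - {i}) G' \<le> bexp q (I - {i}) (\<lambda>x. F' x * G' x)"
      if "mono_on (I - {i} \<rightarrow>\<^sub>E UNIV) F'" "mono_on (I - {i} \<rightarrow>\<^sub>E UNIV) G'" for F' G'
      using q that by (rule bexp_harris)
  qed (use q F G iI in \<open>simp_all add: insert_absorb\<close>)
  moreover have "insert i (I - {i}) = I" using iI by auto
  ultimately show False using uncorrelated by simp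
qed

lemma relevant_of_bool: "relevant q I (\<lambda>x. of_bool (P x) :: real) = relevant q I P"
  unfolding relevant_def of_bool_eq_iff by (rule refl)

lemma relevant_disjoint_events:
  assumes "finite I" and q: "\<And>j b. q j b \<ge> 0" "\<And>j. q j True + q j False = 1"
    and F: "mono_on (I \<rightarrow>\<^sub>E UNIV) F" and G: "mono_on (I \<rightarrow>\<^sub>E UNIV) G"
    and uncorrelated: "bexp q I (\<lambda>x. of_bool (F x \<and> G x)) =
      bexp q I (\<lambda>x. of_bool (F x)) * bexp q I (\<lambda>x. of_bool (G x))"
  shows "relevant q I F \<inter> relevant q I G = {}"
proof -
  have mono: "mono_on (I \<rightarrow>\<^sub>E UNIV) (\<lambda>x. of_bool (H x) :: real)"
    if "mono_on (I \<rightarrow>\<^sub>E UNIV) H" for H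
    using mono_onD[OF that] by (intro mono_onI) (simp add: le_bool_def)
  have "relevant q I (\<lambda>x. of_bool (F x) :: real) \<inter> relevant q I (\<lambda>x. of_bool (G x) :: real) = {}"
    using uncorrelated unfolding of_bool_conj
    by (rule relevant_disjoint[OF assms(1) q mono[OF F] mono[OF G]])
  then show ?thesis by (simp only: relevant_of_bool)
qed

lemma mono_on_disj: "\<lbrakk>mono_on S F; mono_on S G\<rbrakk> \<Longrightarrow> mono_on S (\<lambda>x. F x \<or> G x)"
  by (simp add: mono_on_def le_bool_def) blast

lemma mono_on_conj: "\<lbrakk>mono_on S F; mono_on S G\<rbrakk> \<Longrightarrow> mono_on S (\<lambda>x. F x \<and> G x)"
  by (simp add: mono_on_def le_bool_def) blast

section \<open>Invariance under changes of irrelevant coordinates\<close>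

lemma not_relevantD:
  assumes "i \<notin> relevant q I F" "i \<in> I" "x(i := b) \<in> supp q I" "x(i := c) \<in> supp q I"
  shows "F (x(i := b)) = F (x(i := c))"
proof -
  have "F (x(i := True)) = F (x(i := False))"
    if "x(i := True) \<in> supp q I" "x(i := False) \<in> supp q I"
    using assms(1,2) that unfolding relevant_def by blast
  with assms(3,4) show ?thesis by (cases b; cases c) simp_all
qed

text \<open>\<open>x\<close> is turned into \<open>y\<close> one coordinate at a time. The support
  is a product set, so every hybrid point stays in it, and only irrelevant coordinates actually
  change.\<close>

lemma eq_if_agree_on_relevant:
  assumes "finite I" and "x \<in> supp q I" "y \<in> supp q I"
    and "\<And>j. j \<in> relevant q I F \<Longrightarrow> x j = y j"
  shows "F x = F y"
proof -
  define z where "z = (\<lambda>J j. if j \<in> J then y j else x j)"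
  have "F (z J) = F x" if "J \<subseteq> I" for J
    using finite_subset[OF that assms(1)] that
  proof (induction J rule: finite_induct)
    case empty
    then show ?case by (simp add: z_def)
  next
    case (insert i J)
    have z: "z K \<in> supp q I" for K
      using assms(2,3) by (auto simp: z_def supp_def PiE_def extensional_def)
    have upd: "z (insert i J) = (z J)(i := y i)" "z J = (z J)(i := x i)"
      using insert.hyps by (auto simp: z_def fun_eq_iff)
    have "F (z (insert i J)) = F ((z J)(i := y i))" by (simp only: upd(1))
    also have "\<dots> = F ((z J)(i := x i))"
    proof (cases "x i = y i")
      case False
      then have "i \<notin> relevant q I F" using assms(4) by blast
      moreover have "i \<in> I" using insert.prems by simp
      ultimately show ?thesis
        by (rule not_relevantD) (use z[of J] z[of "insert i J"] upd in metis)+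
    qed simp
    also have "\<dots> = F (z J)" by (simp only: upd(2)[symmetric])
    finally have "F (z (insert i J)) = F (z J)" .
    then show ?case using insert by simp
  qed
  moreover have "z I = y"
    using assms(2,3) by (auto simp: z_def supp_def PiE_def extensional_def fun_eq_iff)
  ultimately show ?thesis by (metis subset_refl)
qed

text \<open>The coordinates relevant for \<open>a\<close> are taken from \<open>y\<close>, those
  relevant for \<open>b\<close> from \<open>z\<close>. The value of \<open>u\<close> is followed
  through \<open>x\<close>, \<open>s\<close>, \<open>w\<close> and that of \<open>v\<close> through
  \<open>x\<close>, \<open>t\<close>, \<open>w\<close>: the order of the two changes
  differs.\<close>

lemma resampling:
  fixes a b u v :: "('i \<Rightarrow> bool) \<Rightarrow> bool"
  assumes I: "finite I"
    and disj: "relevant q I a \<inter> relevant q I b = {}"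
      "relevant q I a \<inter> relevant q I (\<lambda>x. b x \<or> u x) = {}"
      "relevant q I a \<inter> relevant q I (\<lambda>x. b x \<and> v x) = {}"
      "relevant q I b \<inter> relevant q I (\<lambda>x. a x \<or> u x) = {}"
      "relevant q I b \<inter> relevant q I (\<lambda>x. a x \<and> v x) = {}"
    and x: "x \<in> supp q I" "a x" "\<not> b x" "u x" "\<not> v x"
    and y: "y \<in> supp q I" "\<not> a y" and z: "z \<in> supp q I" "b z"
  obtains w where "w \<in> supp q I" "\<not> a w" "b w" "u w" "\<not> v w"
proof -
  define s where "s = (\<lambda>j. if j \<in> relevant q I a then y j else x j)"
  define t where "t = (\<lambda>j. if j \<in> relevant q I b then z j else x j)"
  define w where
    "w = (\<lambda>j. if j \<in> relevant q I a then y j else if j \<in> relevant q I b then z j else x j)"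
  note eq = eq_if_agree_on_relevant[OF I]
  have mem: "s \<in> supp q I" "t \<in> supp q I" "w \<in> supp q I"
    using x(1) y(1) z(1) by (auto simp: s_def t_def w_def supp_def PiE_def extensional_def)
  have "a w = a y" by (rule eq) (use mem y in \<open>auto simp: w_def\<close>)
  moreover have "b w = b z" by (rule eq) (use mem z disj in \<open>auto simp: w_def\<close>)
  moreover have "b s = b x" by (rule eq) (use mem x disj in \<open>auto simp: s_def\<close>)
  moreover have "a t = a x" by (rule eq) (use mem x disj in \<open>auto simp: t_def\<close>)
  \<comment> \<open>A disjunction reveals \<open>u\<close> when its other member is false:
    \<open>b\<close> is false at \<open>s\<close>, and \<open>a\<close> is false at
    \<open>w\<close>. Hence \<open>u\<close> stays true.\<close>
  moreover have "(b s \<or> u s) = (b x \<or> u x)"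
    by (rule eq[where F = "\<lambda>x. b x \<or> u x"]) (use mem x disj in \<open>auto simp: s_def\<close>)
  moreover have "(a w \<or> u w) = (a s \<or> u s)"
    by (rule eq[where F = "\<lambda>x. a x \<or> u x"]) (use mem disj in \<open>auto simp: s_def w_def\<close>)
  \<comment> \<open>Dually, a conjunction reveals \<open>v\<close> when its other member is true:
    \<open>a\<close> holds at \<open>t\<close>, and \<open>b\<close> holds at \<open>w\<close>.
    Hence \<open>v\<close> stays false.\<close>
  moreover have "(a t \<and> v t) = (a x \<and> v x)"
    by (rule eq[where F = "\<lambda>x. a x \<and> v x"]) (use mem x disj in \<open>auto simp: t_def\<close>)
  moreover have "(b w \<and> v w) = (b t \<and> v t)"
    by (rule eq[where F = "\<lambda>x. b x \<and> v x"]) (use mem disj in \<open>auto simp: t_def w_def\<close>)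
  ultimately have "\<not> a w" "b w" "u w" "\<not> v w" using x y z by auto
  with mem(3) show thesis by (rule that)
qed

subsection \<open>Laws of increasing functions of independent Bernoulli variables\<close>

text \<open>By independence the joint law of the Bernoulli variables is determined by their
  marginals \<open>q\<close>, so the abstract sample space can be replaced by finite sums.\<close>

lemma FUI_measure:
  assumes "FUI n \<mu>"
  obtains m q f where "\<And>j b. q j b \<ge> 0" "\<And>j. q j True + q j False = 1"
    "\<And>i. i < n \<Longrightarrow> mono_on (cube m) (f i)"
    "\<And>A. A \<subseteq> cube n \<Longrightarrow>
      measure \<mu> A = bexp q {..<m} (\<lambda>x. of_bool ((\<lambda>i\<in>{..<n}. f i x) \<in> A))"
proof -
  obtain M :: "(nat \<Rightarrow> bool) measure" where M: "FUI_over M n \<mu>"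
    using assms by (auto simp: FUI_def)
  interpret prob_space M using M by (simp add: FUI_over_def)
  obtain m Y f where ind: "indep_vars (\<lambda>_. count_space UNIV) Y {..<m}"
    and mono: "\<forall>i<n. mono_on (cube m) (f i)"
    and \<mu>: "\<mu> = distr M (count_space (cube n)) (\<lambda>\<omega>. \<lambda>i\<in>{..<n}. f i (\<lambda>j\<in>{..<m}. Y j \<omega>))"
    using M unfolding FUI_over_def by (elim conjE exE) (erule that, assumption, assumption)
  text \<open>Coordinates from \<open>m\<close> on play no role; any probability weights will do there.\<close>
  define q where "q = (\<lambda>j b. if j < m then prob (Y j -` {b} \<inter> space M) else 1 / 2)"
  define \<phi> where "\<phi> = (\<lambda>\<omega>. \<lambda>j\<in>{..<m}. Y j \<omega>)"
  define X where "X = (\<lambda>x. \<lambda>i\<in>{..<n}. f i x)"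
  have Y: "Y j -` B \<inter> space M \<in> events" if "j < m" for j B
    using ind that by (auto simp: indep_vars_def2 intro: measurable_sets)
  have \<phi>_cube: "\<phi> \<omega> \<in> cube m" for \<omega> by (simp add: \<phi>_def cube_def)
  have fibre: "\<phi> -` {x} \<inter> space M = {\<omega> \<in> space M. \<forall>j\<in>{..<m}. Y j \<omega> = x j}"
    if "x \<in> cube m" for x
    using that by (auto simp: \<phi>_def cube_def fun_eq_iff PiE_def extensional_def)
  have fibre_event: "\<phi> -` {x} \<inter> space M \<in> events" if "x \<in> cube m" for x
    unfolding fibre[OF that]
  proof (rule sets.sets_Collect_finite_All)
    show "{\<omega> \<in> space M. Y j \<omega> = x j} \<in> events" if "j \<in> {..<m}" for j
      using Y[of j "{x j}"] that by (simp add: vimage_def Int_def conj_commute)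
  qed simp
  have fibre_prob: "prob (\<phi> -` {x} \<inter> space M) = (\<Prod>j<m. q j (x j))" if x: "x \<in> cube m" for x
  proof (cases "m = 0")
    \<comment> \<open>An intersection over no indices would be the universe instead of the sample
      space, hence the separate case.\<close>
    case True
    then show ?thesis by (simp add: fibre[OF x] prob_space)
  next
    case False
    then have "prob (\<phi> -` {x} \<inter> space M) = prob (\<Inter>j\<in>{..<m}. Y j -` {x j} \<inter> space M)"
      unfolding fibre[OF x] by (intro arg_cong[where f = prob]) (auto simp: lessThan_empty_iff)
    also have "\<dots> = (\<Prod>j<m. prob (Y j -` {x j} \<inter> space M))"
      using False by (intro indep_varsD[OF ind]) auto
    finally show ?thesis by (simp add: q_def)
  qed
  have pre: "\<phi> -` B \<inter> space M = (\<Union>x\<in>B \<inter> cube m. \<phi> -` {x} \<inter> space M)" for B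
    using \<phi>_cube by auto
  have \<phi>: "\<phi> \<in> measurable M (count_space (cube m))"
    using \<phi>_cube fibre_event by (subst measurable_count_space_eq2[OF finite_cube]) auto
  have X: "X \<in> measurable (count_space (cube m)) (count_space (cube n))"
    by (auto simp: X_def cube_def)
  have X\<phi>: "(\<lambda>\<omega>. X (\<phi> \<omega>)) \<in> measurable M (count_space (cube n))"
    using measurable_comp[OF \<phi> X] by (simp add: comp_def)
  have law: "measure \<mu> A = bexp q {..<m} (\<lambda>x. of_bool (X x \<in> A))" if "A \<subseteq> cube n" for A
  proof -
    have "measure \<mu> A = prob ((\<lambda>\<omega>. X (\<phi> \<omega>)) -` A \<inter> space M)"
      unfolding \<mu> using that X\<phi> by (subst measure_distr) (auto simp: X_def \<phi>_def)
    also have "(\<lambda>\<omega>. X (\<phi> \<omega>)) -` A \<inter> space M = (\<Union>x\<in>X -` A \<inter> cube m. \<phi> -` {x} \<inter> space M)"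
      using pre[of "X -` A"] by auto
    also have "prob \<dots> = (\<Sum>x\<in>X -` A \<inter> cube m. prob (\<phi> -` {x} \<inter> space M))"
      using finite_cube fibre_event
      by (intro finite_measure_finite_Union) (auto simp: disjoint_family_on_def)
    also have "\<dots> = (\<Sum>x\<in>cube m. (\<Prod>j<m. q j (x j)) * of_bool (X x \<in> A))"
      using finite_cube fibre_prob by (intro sum.mono_neutral_cong_left) auto
    finally show ?thesis by (simp add: bexp_def cube_def)
  qed
  have "q j True + q j False = 1" for j
  proof (cases "j < m")
    case True
    have "Y j -` {False} \<inter> space M = space M - Y j -` {True} \<inter> space M" by auto
    then show ?thesis using prob_compl[OF Y[OF True]] True by (simp add: q_def)
  qed (simp add: q_def)
  then show thesis
    using mono law by (intro that[of q m f]) (auto simp: q_def X_def)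
qed

subsection \<open>The counterexample\<close>

definition vec4 :: "bool \<Rightarrow> bool \<Rightarrow> bool \<Rightarrow> bool \<Rightarrow> nat \<Rightarrow> bool" where
  "vec4 a b u v = (\<lambda>i\<in>{..<4}. if i = 0 then a else if i = 1 then b else if i = 2 then u else v)"

text \<open>Two further fair coins realise the conditional laws: \<open>(u, v)\<close> is (c,0),
  (c,c), (c,d), (1,c) for ab = 00, 01, 10, 11. The map is nondecreasing in \<open>a\<close>,
  \<open>c\<close> and \<open>d\<close> but not in \<open>b\<close>: for a = 1, c = 0, d = 1,
  raising \<open>b\<close> lowers \<open>v\<close>. So it is no FUI representation.\<close>

definition witness_map :: "bool \<times> bool \<times> bool \<times> bool \<Rightarrow> nat \<Rightarrow> bool" where
  "witness_map = (\<lambda>(a, b, c, d).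
     vec4 a b (c \<or> a \<and> b) (if a then (if b then c else d) else b \<and> c))"

definition witness :: "(nat \<Rightarrow> bool) measure" where
  "witness = distr (measure_pmf (pmf_of_set UNIV)) (count_space (cube 4)) witness_map"

lemma vec4_cube: "vec4 a b u v \<in> cube 4"
  by (simp add: vec4_def cube_def)

lemma vec4_le: "\<lbrakk>a \<le> a'; b \<le> b'; u \<le> u'; v \<le> v'\<rbrakk> \<Longrightarrow> vec4 a b u v \<le> vec4 a' b' u' v'"
  by (auto simp: vec4_def le_fun_def)

lemma witness_map_cube: "witness_map x \<in> cube 4"
  by (simp add: witness_map_def vec4_cube split: prod.split)

section \<open>Averages over fair coins\<close>

definition coin_avg :: "(bool \<Rightarrow> real) \<Rightarrow> real" where
  "coin_avg F = (F False + F True) / 2"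

text \<open>Chebyshev's sum inequality on two points.\<close>

lemma coin_avg_prod:
  assumes "F False \<le> F True" "G False \<le> G True"
  shows "coin_avg F * coin_avg G \<le> coin_avg (\<lambda>b. F b * G b)"
proof -
  have "0 \<le> (F True - F False) * (G True - G False)" using assms by simp
  then show ?thesis by (simp add: coin_avg_def field_simps)
qed

lemma coin_avg_mono: "(\<And>b. F b \<le> G b) \<Longrightarrow> coin_avg F \<le> coin_avg G"
  unfolding coin_avg_def by (intro divide_right_mono add_mono) auto

lemma coin_avg_swap: "coin_avg (\<lambda>c. coin_avg (F c)) = coin_avg (\<lambda>d. coin_avg (\<lambda>c. F c d))"
  by (simp add: coin_avg_def field_simps)

lemma sum_UNIV_prod:
  fixes h :: "'a::finite \<times> 'b::finite \<Rightarrow> real"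
  shows "(\<Sum>x\<in>UNIV. h x) = (\<Sum>a\<in>UNIV. \<Sum>b\<in>UNIV. h (a, b))"
proof -
  have "(\<Sum>a\<in>UNIV. \<Sum>b\<in>UNIV. h (a, b)) = (\<Sum>(a, b)\<in>UNIV \<times> UNIV. h (a, b))"
    by (rule sum.cartesian_product)
  then show ?thesis by (simp add: split_def)
qed

lemma coin_avg_sum:
  "coin_avg (\<lambda>a. coin_avg (\<lambda>b. coin_avg (\<lambda>c. coin_avg (\<lambda>d. h (a, b, c, d))))) =
    (\<Sum>x\<in>UNIV. h x) / 16"
  by (simp add: sum_UNIV_prod UNIV_bool coin_avg_def field_simps)

text \<open>Nested averages expose the coins one by one, as the proof of positive association
  requires.\<close>

lemma measure_witness:
  assumes "A \<subseteq> cube 4"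
  shows "measure witness A = coin_avg (\<lambda>a. coin_avg (\<lambda>b. coin_avg (\<lambda>c. coin_avg (\<lambda>d.
    of_bool (witness_map (a, b, c, d) \<in> A)))))"
proof -
  have "measure witness A = real (card (witness_map -` A)) / 16"
    unfolding witness_def using assms witness_map_cube
    by (subst measure_distr) (auto simp: measure_pmf_of_set card_UNIV_bool)
  also have "real (card (witness_map -` A)) = (\<Sum>x\<in>UNIV. of_bool (witness_map x \<in> A))"
    by (simp add: sum.If_cases of_bool_def vimage_def)
  finally show ?thesis
    using coin_avg_sum[of "\<lambda>x. of_bool (witness_map x \<in> A)"] by simp
qed

lemma prob_measure_on_cube_witness: "prob_measure_on_cube 4 witness"
  unfolding prob_measure_on_cube_def witness_def
  using witness_map_cube by (auto intro!: prob_space.prob_space_distr prob_space_measure_pmf)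

text \<open>The two-point inequality is applied to \<open>a\<close>, \<open>b\<close>,
  \<open>c\<close>, \<open>d\<close> in turn. It requires the indicator of an increasing event,
  averaged over the later coins, to be nondecreasing in the current one. Such averaging compensates
  for the missing pointwise monotonicity in \<open>b\<close>.\<close>

lemma positively_associated_witness: "positively_associated 4 witness"
  unfolding positively_associated_def
proof (intro allI impI)
  fix A B assume A: "increasing_event 4 A" and B: "increasing_event 4 B"
  define \<alpha> :: "(nat \<Rightarrow> bool) set \<Rightarrow> bool \<Rightarrow> bool \<Rightarrow> bool \<Rightarrow> bool \<Rightarrow> real"
    where "\<alpha> C a b c d = of_bool (witness_map (a, b, c, d) \<in> C)" for C a b c d
  let ?d = "\<lambda>C a b c. coin_avg (\<alpha> C a b c)"
  let ?c = "\<lambda>C a b. coin_avg (?d C a b)"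
  let ?b = "\<lambda>C a. coin_avg (?c C a)"
  have mono: "\<alpha> C a b c d \<le> \<alpha> C a' b' c' d'"
    if "increasing_event 4 C" "witness_map (a, b, c, d) \<le> witness_map (a', b', c', d')"
    for C a b c d a' b' c' d'
    using that witness_map_cube unfolding \<alpha>_def increasing_event_def by auto
  have d: "\<alpha> C a b c False \<le> \<alpha> C a b c True" if "increasing_event 4 C" for C a b c
    by (rule mono[OF that]) (simp add: witness_map_def vec4_le le_bool_def)
  have c: "?d C a b False \<le> ?d C a b True" if "increasing_event 4 C" for C a b
    by (intro coin_avg_mono mono[OF that]) (simp add: witness_map_def vec4_le le_bool_def)
  have b: "?c C a False \<le> ?c C a True" if "increasing_event 4 C" for C a
  proof (cases a)
    case True
    text \<open>Here \<open>v\<close> is \<open>d\<close> if \<open>b\<close> fails and \<open>c\<close> if \<open>b\<close> holds, so the coins have to be swapped.\<close>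
    have "?c C True False \<le> coin_avg (\<lambda>c. coin_avg (\<lambda>d. \<alpha> C True True d c))"
      by (intro coin_avg_mono mono[OF that]) (simp add: witness_map_def vec4_le le_bool_def)
    also have "\<dots> = ?c C True True" by (rule coin_avg_swap)
    finally show ?thesis using True by simp
  next
    case False
    then show ?thesis
      by (intro coin_avg_mono mono[OF that]) (simp add: witness_map_def vec4_le le_bool_def)
  qed
  \<comment> \<open>Here the comparison is pointwise: (c,0) lies below (c,d) when b = 0, and (c,c)
    below (1,c) when b = 1.\<close>
  have a: "?b C False \<le> ?b C True" if "increasing_event 4 C" for C
    by (intro coin_avg_mono mono[OF that]) (simp add: witness_map_def vec4_le le_bool_def)
  have "?b A a * ?b B a \<le> coin_avg (\<lambda>b. coin_avg (\<lambda>c. coin_avg (\<lambda>d. \<alpha> A a b c d * \<alpha> B a b c d)))"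
    for a
    by (rule order.trans[OF coin_avg_prod[OF b[OF A] b[OF B]]], rule coin_avg_mono,
        rule order.trans[OF coin_avg_prod[OF c[OF A] c[OF B]]], rule coin_avg_mono,
        rule coin_avg_prod[OF d[OF A] d[OF B]])
  from order.trans[OF coin_avg_prod[OF a[OF A] a[OF B]] coin_avg_mono, OF this]
  have "coin_avg (?b A) * coin_avg (?b B) \<le>
    coin_avg (\<lambda>a. coin_avg (\<lambda>b. coin_avg (\<lambda>c. coin_avg (\<lambda>d. \<alpha> A a b c d * \<alpha> B a b c d))))" .
  moreover have "\<alpha> A a b c d * \<alpha> B a b c d = \<alpha> (A \<inter> B) a b c d" for a b c d
    by (simp add: \<alpha>_def)
  moreover have "measure witness C = coin_avg (?b C)" if "C \<subseteq> cube 4" for C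
    unfolding measure_witness[OF that] \<alpha>_def ..
  moreover have "A \<subseteq> cube 4" "B \<subseteq> cube 4" "A \<inter> B \<subseteq> cube 4"
    using A B by (auto simp: increasing_event_def)
  ultimately show "measure witness A * measure witness B \<le> measure witness (A \<inter> B)"
    by simp
qed

lemma not_FUI_witness: "\<not> FUI 4 witness"
proof
  assume "FUI 4 witness"
  then obtain m q f where q: "\<And>j b. q j b \<ge> 0" "\<And>j. q j True + q j False = 1"
    and mono: "\<And>i. i < 4 \<Longrightarrow> mono_on (cube m) (f i)"
    and law: "\<And>A. A \<subseteq> cube 4 \<Longrightarrow>
      measure witness A = bexp q {..<m} (\<lambda>x. of_bool ((\<lambda>i\<in>{..<4}. f i x) \<in> A))"
    by (rule FUI_measure) blast
  let ?I = "{..<m}"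
  let ?a = "f 0" and ?b = "f 1" and ?u = "f 2" and ?v = "f 3"
  \<comment> \<open>Leaving \<open>P\<close> arbitrary lets every probability needed below be
    computed by instantiation.\<close>
  have expectation: "bexp q ?I (\<lambda>x. of_bool (P (?a x) (?b x) (?u x) (?v x))) =
      coin_avg (\<lambda>a. coin_avg (\<lambda>b. coin_avg (\<lambda>c. coin_avg (\<lambda>d.
        of_bool (P a b (c \<or> a \<and> b) (if a then (if b then c else d) else b \<and> c))))))" for P
  proof -
    let ?A = "{x \<in> cube 4. P (x 0) (x 1) (x 2) (x 3)}"
    have "bexp q ?I (\<lambda>x. of_bool (P (?a x) (?b x) (?u x) (?v x))) = measure witness ?A"
      by (subst law) (auto simp: cube_def)
    also have "\<dots> = coin_avg (\<lambda>a. coin_avg (\<lambda>b. coin_avg (\<lambda>c. coin_avg (\<lambda>d.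
        of_bool (P a b (c \<or> a \<and> b) (if a then (if b then c else d) else b \<and> c))))))"
      by (subst measure_witness) (auto simp: witness_map_def vec4_cube, simp add: vec4_def)
    finally show ?thesis .
  qed
  have mono4: "mono_on (?I \<rightarrow>\<^sub>E UNIV) ?a" "mono_on (?I \<rightarrow>\<^sub>E UNIV) ?b"
    "mono_on (?I \<rightarrow>\<^sub>E UNIV) ?u" "mono_on (?I \<rightarrow>\<^sub>E UNIV) ?v"
    using mono by (simp_all add: cube_def)
  note disjoint = relevant_disjoint_events[OF finite_lessThan q]
  \<comment> \<open>Points off the support have weight zero, so an event of positive probability
    meets the support.\<close>
  have pos: "\<exists>x\<in>supp q ?I. P (?a x) (?b x) (?u x) (?v x)"
    if "bexp q ?I (\<lambda>x. of_bool (P (?a x) (?b x) (?u x) (?v x))) > 0" for P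
  proof (rule ccontr)
    assume "\<not> ?thesis"
    then have "(\<Prod>j<m. q j (x j)) * of_bool (P (?a x) (?b x) (?u x) (?v x)) = 0"
      if x: "x \<in> ?I \<rightarrow>\<^sub>E UNIV" for x
    proof (cases "x \<in> supp q ?I")
      case False
      then obtain j where "j < m" "q j (x j) \<le> 0"
        using x by (auto simp: supp_def not_less)
      then have "\<exists>j\<in>?I. q j (x j) = 0" using q(1) by (auto intro!: bexI[of _ j] antisym)
      then show ?thesis by (simp add: prod_zero)
    qed simp
    then have "bexp q ?I (\<lambda>x. of_bool (P (?a x) (?b x) (?u x) (?v x))) = 0"
      unfolding bexp_def by (intro sum.neutral ballI)
    with that show False by simp
  qed
  obtain x where x: "x \<in> supp q ?I" "?a x" "\<not> ?b x" "?u x" "\<not> ?v x"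
    using pos[of "\<lambda>a b u v. a \<and> \<not> b \<and> u \<and> \<not> v"]
      expectation[of "\<lambda>a b u v. a \<and> \<not> b \<and> u \<and> \<not> v"] by (auto simp: coin_avg_def)
  obtain y where y: "y \<in> supp q ?I" "\<not> ?a y"
    using pos[of "\<lambda>a b u v. \<not> a"] expectation[of "\<lambda>a b u v. \<not> a"] by (auto simp: coin_avg_def)
  obtain z where z: "z \<in> supp q ?I" "?b z"
    using pos[of "\<lambda>a b u v. b"] expectation[of "\<lambda>a b u v. b"] by (auto simp: coin_avg_def)
  \<comment> \<open>The five joint probabilities factor: 1/4 = 1/2 * 1/2, 3/8 = 1/2 * 3/4 and 1/8 =
    1/2 * 1/4, the last two occurring twice.\<close>
  have moments:
    "bexp q ?I (\<lambda>x. of_bool (?a x)) = 1 / 2"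
    "bexp q ?I (\<lambda>x. of_bool (?b x)) = 1 / 2"
    "bexp q ?I (\<lambda>x. of_bool (?a x \<and> ?b x)) = 1 / 4"
    "bexp q ?I (\<lambda>x. of_bool (?b x \<or> ?u x)) = 3 / 4"
    "bexp q ?I (\<lambda>x. of_bool (?a x \<and> (?b x \<or> ?u x))) = 3 / 8"
    "bexp q ?I (\<lambda>x. of_bool (?b x \<and> ?v x)) = 1 / 4"
    "bexp q ?I (\<lambda>x. of_bool (?a x \<and> ?b x \<and> ?v x)) = 1 / 8"
    "bexp q ?I (\<lambda>x. of_bool (?a x \<or> ?u x)) = 3 / 4"
    "bexp q ?I (\<lambda>x. of_bool (?b x \<and> (?a x \<or> ?u x))) = 3 / 8"
    "bexp q ?I (\<lambda>x. of_bool (?a x \<and> ?v x)) = 1 / 4"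
    "bexp q ?I (\<lambda>x. of_bool (?b x \<and> ?a x \<and> ?v x)) = 1 / 8"
    using expectation[of "\<lambda>a b u v. a"]
      expectation[of "\<lambda>a b u v. b"]
      expectation[of "\<lambda>a b u v. a \<and> b"]
      expectation[of "\<lambda>a b u v. b \<or> u"]
      expectation[of "\<lambda>a b u v. a \<and> (b \<or> u)"]
      expectation[of "\<lambda>a b u v. b \<and> v"]
      expectation[of "\<lambda>a b u v. a \<and> b \<and> v"]
      expectation[of "\<lambda>a b u v. a \<or> u"]
      expectation[of "\<lambda>a b u v. b \<and> (a \<or> u)"]
      expectation[of "\<lambda>a b u v. a \<and> v"]
      expectation[of "\<lambda>a b u v. b \<and> a \<and> v"]
    unfolding coin_avg_def by simp_all
  have "relevant q ?I ?a \<inter> relevant q ?I ?b = {}"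
    by (intro disjoint mono4 mono_on_disj mono_on_conj) (simp only: moments)
  moreover have "relevant q ?I ?a \<inter> relevant q ?I (\<lambda>x. ?b x \<or> ?u x) = {}"
    by (intro disjoint mono4 mono_on_disj mono_on_conj) (simp only: moments)
  moreover have "relevant q ?I ?a \<inter> relevant q ?I (\<lambda>x. ?b x \<and> ?v x) = {}"
    by (intro disjoint mono4 mono_on_disj mono_on_conj) (simp only: moments)
  moreover have "relevant q ?I ?b \<inter> relevant q ?I (\<lambda>x. ?a x \<or> ?u x) = {}"
    by (intro disjoint mono4 mono_on_disj mono_on_conj) (simp only: moments)
  moreover have "relevant q ?I ?b \<inter> relevant q ?I (\<lambda>x. ?a x \<and> ?v x) = {}"
    by (intro disjoint mono4 mono_on_disj mono_on_conj) (simp only: moments)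
  ultimately obtain w where w: "w \<in> supp q ?I" "\<not> ?a w" "?b w" "?u w" "\<not> ?v w"
    by (rule resampling[where a = ?a and b = ?b and u = ?u and v = ?v,
          OF finite_lessThan _ _ _ _ _ x y z])
  \<comment> \<open>The point \<open>w\<close> alone contributes positive weight to 0110, whereas
    under \<open>witness\<close> ab = 01 forces \<open>u\<close> and \<open>v\<close> to be
    equal.\<close>
  have "0 < bexp q ?I (\<lambda>x. of_bool (\<not> ?a x \<and> ?b x \<and> ?u x \<and> \<not> ?v x))"
    by (rule bexp_pos[where x = w]) (use w q in \<open>auto simp: supp_def\<close>)
  then show False
    using expectation[of "\<lambda>a b u v. \<not> a \<and> b \<and> u \<and> \<not> v"] by (simp add: coin_avg_def)
qed

theorem corollary4:
  shows "\<exists>(n :: nat) (\<mu> :: (nat \<Rightarrow> bool) measure).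
    n \<ge> 1 \<and> prob_measure_on_cube n \<mu> \<and> positively_associated n \<mu> \<and> \<not> FUI n \<mu>"
  using prob_measure_on_cube_witness positively_associated_witness not_FUI_witness
  by (intro exI[of _ 4] exI[of _ witness]) simp

end
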